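(* Let $\{P_\theta\}_{\theta\in\Theta}$ be a family of probability measures on a measurable space $(\Omega,\mathcal{F})$, where $\Theta$ is partitioned into $\Theta_0$ (null) and $\Theta_1$ (alternative), let $\mathcal{P}=\{P_\theta\}_{\theta\in\Theta_0}$, and let $\mathcal{P}_{\mathrm{eff}}$ be the effective null hypothesis of $\mathcal{P}$. Let $\theta\in\Theta$. If $$\inf_{P\in\mathcal{P}_{\mathrm{eff}}}D_{\mathrm{KL}}(P_\theta\,\|\,P)<\infty,$$ then $\mathbb{E}_\theta[\log(E)]$ is defined for every e-variable $E$ for $\Theta_0$.
   Context: $\mathbb{E}_\theta$ denotes expectation under $P_\theta$. The expectation $\mathbb{E}[Y]$ of a $[-\infty,\infty]$-valued random variable $Y$ is defined if $\mathbb{E}[Y^+]$ or $\mathbb{E}[Y^-]$ is finite. Conventions: $\log 0=-\infty$, $\log\infty=\infty$. An e-variable for $\Theta_0$ is a $[0,\infty]$-valued random variable $E$ on $\Omega$ with $\mathbb{E}_P[E]\le1$ for all $P\in\mathcal{P}$. Let $\mathcal{E}$ be the set of all e-variables for $\Theta_0$, and $M_+$ the set of (nonnegative) measures on $(\Omega,\mathcal{F})$. The effective null hypothesis is $$\mathcal{P}_{\mathrm{eff}}:=\{P\in M_+ : \mathbb{E}_P[E]\le1\text{ for all }E\in\mathcal{E}\},$$ where $\mathbb{E}_P[E]=\int E\,dP$; it consists of sub-probability measures. For finite measures $\mu,\nu$, the KL-divergence is $D_{\mathrm{KL}}(\mu\|\nu)=\int\log\left(\frac{d\mu}{d\nu}\right)d\mu$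 if $\mu\ll\nu$, and $+\infty$ otherwise. *)

theory Defs
  imports "HOL-Probability.Probability"
begin

text \<open>
  A measurable space $(\Omega, F)$ is represented by a measure \<open>M\<close> of which only
  \<open>space M\<close> and \<open>sets M\<close> are used; a measure on it is any \<open>Q\<close> with \<open>sets Q = sets M\<close>.
\<close>

definition elog :: "ennreal \<Rightarrow> ereal" where
  "elog x = (if x = 0 then -\<infinity> else if x = \<infinity> then \<infinity> else ereal (ln (enn2real x)))"

text \<open>
  \<open>e2ennreal\<close> maps negative values to \<open>0\<close>, so \<open>e2ennreal \<circ> Y\<close> and \<open>e2ennreal \<circ> (- Y)\<close>
  are the positive and negative parts of \<open>Y\<close>.
\<close>

definition expectation_defined :: "'a measure \<Rightarrow> ('a \<Rightarrow> ereal) \<Rightarrow> bool" where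
  "expectation_defined P Y \<longleftrightarrow>
     Y \<in> borel_measurable P \<and>
     ((\<integral>\<^sup>+ x. e2ennreal (Y x) \<partial>P) < \<infinity> \<or> (\<integral>\<^sup>+ x. e2ennreal (- Y x) \<partial>P) < \<infinity>)"

text \<open>The value is meaningful only if \<open>expectation_defined P Y\<close>.\<close>

definition eintegral :: "'a measure \<Rightarrow> ('a \<Rightarrow> ereal) \<Rightarrow> ereal" where
  "eintegral P Y =
     enn2ereal (\<integral>\<^sup>+ x. e2ennreal (Y x) \<partial>P) - enn2ereal (\<integral>\<^sup>+ x. e2ennreal (- Y x) \<partial>P)"

definition e_variables :: "'a measure \<Rightarrow> 'a measure set \<Rightarrow> ('a \<Rightarrow> ennreal) set" where
  "e_variables M \<P> = {E \<in> borel_measurable M. \<forall>P\<in>\<P>. (\<integral>\<^sup>+ x. E x \<partial>P) \<le> 1}"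

definition effective_null :: "'a measure \<Rightarrow> 'a measure set \<Rightarrow> 'a measure set" where
  "effective_null M \<P> = {Q. sets Q = sets M \<and> (\<forall>E\<in>e_variables M \<P>. (\<integral>\<^sup>+ x. E x \<partial>Q) \<le> 1)}"

text \<open>
  Divergence of finite measures on the same measurable space. \<open>absolutely_continuous \<nu> \<mu>\<close>
  is $\mu \ll \nu$, and \<open>RN_deriv \<nu> \<mu>\<close> is $d\mu/d\nu$. The negative part of the integrand is
  \<open>\<mu>\<close>-integrable because $t \log t$ is bounded below and \<open>\<nu>\<close> is finite. The library's
  real-valued \<open>KL_divergence\<close> is unsuitable: it is \<open>0\<close> when the integral is infinite.
\<close>

definition KL_div :: "'a measure \<Rightarrow> 'a measure \<Rightarrow> ereal" where
  "KL_div \<mu> \<nu> =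
     (if absolutely_continuous \<nu> \<mu> then eintegral \<mu> (\<lambda>x. elog (RN_deriv \<nu> \<mu> x)) else \<infinity>)"

end

theory Submission
  imports Defs
begin

text \<open>
  Take \<open>Q\<close> in the effective null hypothesis with finite divergence from \<open>P\<close> and let \<open>f = dP/dQ\<close>.
  Since $\log(E/f) \le E/f$, we have $f \log^+ E \le f \log^+ f + E$. Integrating over \<open>Q\<close> gives
  $E_P[\log^+ E] \le E_P[\log^+ f] + E_Q[E]$. The first term is finite because the divergence
  is, and the second is at most \<open>1\<close>.
\<close>

lemma borel_measurable_elog [measurable]: "elog \<in> borel_measurable borel"
  unfolding elog_def by measurable

text \<open>The pointwise form of the bound, valid at infinite values too: if \<open>f\<close> or
  \<open>e\<close> is infinite, so is the right-hand side. For finite values it comes from ln t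
  \<le> t at t = e / f.\<close>

lemma mult_elog_pos_le:
  "f * e2ennreal (elog e) \<le> f * e2ennreal (elog f) + e"
proof (cases f)
  case top
  then show ?thesis
    by (simp add: elog_def ennreal_top_mult e2ennreal_infty)
next
  case (real a)
  show ?thesis
  proof (cases e)
    case (real b)
    show ?thesis
    \<comment> \<open>Here the left-hand side vanishes: \<open>ln b\<close> is finite, so a zero
      factor \<open>a\<close> kills it, and b \<le> 1 makes the positive part of the logarithm zero.
      Otherwise one may divide by \<open>a\<close>, and \<open>ln b\<close> is its own positive
      part.\<close>
    proof (cases "a = 0 \<or> b \<le> 1")
      case True
      then have "f * e2ennreal (elog e) = 0"
        using \<open>f = ennreal a\<close> \<open>0 \<le> b\<close> real
        by (auto simp: elog_def e2ennreal_neg ennreal_neg)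
      then show ?thesis by auto
    next
      case False
      with \<open>0 \<le> a\<close> have ab: "0 < a" "1 < b" by auto
      have "ln (b / a) \<le> b / a"
        using ab ln_bound by simp
      then have "a * (ln b - ln a) \<le> b"
        using ab by (simp add: ln_div field_simps)
      then have "a * ln b \<le> a * ln a + b"
        by (simp add: algebra_simps)
      \<comment> \<open>For a < 1 the term \<open>a * ln a\<close> is negative; the positive part
        keeps every summand nonnegative, so that the inequality passes to
        \<open>ennreal\<close>.\<close>
      also have "\<dots> \<le> a * max 0 (ln a) + b"
        using ab by (simp add: mult_left_mono)
      finally have "ennreal (a * ln b) \<le> ennreal (a * max 0 (ln a)) + ennreal b"
        using ab by (simp flip: ennreal_plus add: ennreal_leI del: ennreal_plus)
      moreover have "e2ennreal (elog f) = ennreal (max 0 (ln a))"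
        using \<open>f = ennreal a\<close> ab by (simp add: elog_def e2ennreal_ereal max_def ennreal_neg)
      moreover have "e2ennreal (elog e) = ennreal (ln b)"
        using real ab by (simp add: elog_def e2ennreal_ereal)
      ultimately show ?thesis
        using \<open>f = ennreal a\<close> real ab by (simp add: ennreal_mult)
    qed
  qed simp
qed

lemma nn_integral_elog_finite:
  assumes Q: "finite_measure Q"
    and sets: "sets \<mu> = sets Q"
    and KL: "KL_div \<mu> Q < \<infinity>"
    and E [measurable]: "E \<in> borel_measurable Q"
    and fin: "(\<integral>\<^sup>+ x. E x \<partial>Q) < \<infinity>"
  shows "(\<integral>\<^sup>+ x. e2ennreal (elog (E x)) \<partial>\<mu>) < \<infinity>"
proof -
  interpret Q: finite_measure Q by (rule Q)
  define f where "f = RN_deriv Q \<mu>"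
  have f [measurable]: "f \<in> borel_measurable Q"
    unfolding f_def by simp
  \<comment> \<open>Otherwise the divergence would be infinite by definition.\<close>
  have ac: "absolutely_continuous Q \<mu>"
    using KL by (auto simp: KL_div_def split: if_splits)
  have \<mu>: "density Q f = \<mu>"
    unfolding f_def using Q.density_RN_deriv[OF ac sets] .
  have int: "(\<integral>\<^sup>+ x. g x \<partial>\<mu>) = (\<integral>\<^sup>+ x. f x * g x \<partial>Q)" if "g \<in> borel_measurable Q" for g
    using nn_integral_density[OF f that] by (simp add: \<mu>)
  \<comment> \<open>In \<open>ereal\<close>, \<infinity> - x = \<infinity> for every x, including x
    = \<infinity>. A difference below \<infinity> therefore has a finite first term, here the
    integral of the positive part.\<close>
  have "(\<integral>\<^sup>+ x. e2ennreal (elog (f x)) \<partial>\<mu>) \<noteq> \<infinity>"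
    using KL ac by (auto simp: KL_div_def eintegral_def f_def)
  then have logf: "(\<integral>\<^sup>+ x. f x * e2ennreal (elog (f x)) \<partial>Q) < \<infinity>"
    by (simp add: int less_top)
  have "(\<integral>\<^sup>+ x. e2ennreal (elog (E x)) \<partial>\<mu>) = (\<integral>\<^sup>+ x. f x * e2ennreal (elog (E x)) \<partial>Q)"
    by (simp add: int)
  also have "\<dots> \<le> (\<integral>\<^sup>+ x. f x * e2ennreal (elog (f x)) + E x \<partial>Q)"
    by (intro nn_integral_mono mult_elog_pos_le)
  also have "\<dots> = (\<integral>\<^sup>+ x. f x * e2ennreal (elog (f x)) \<partial>Q) + (\<integral>\<^sup>+ x. E x \<partial>Q)"
    by (intro nn_integral_add) measurable
  also have "\<dots> < \<infinity>"
    using logf fin by simp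
  finally show ?thesis .
qed

text \<open>The constant 1 is an e-variable, and testing \<open>Q\<close> against it bounds the
  total mass of \<open>Q\<close> by 1.\<close>

lemma effective_null_finite_measure:
  assumes "\<And>P. P \<in> \<P> \<Longrightarrow> emeasure P (space P) \<le> 1"
    and "Q \<in> effective_null M \<P>"
  shows "finite_measure Q"
proof
  have "(\<lambda>_. 1) \<in> e_variables M \<P>"
    using assms(1) by (simp add: e_variables_def)
  then have "(\<integral>\<^sup>+ x. 1 \<partial>Q) \<le> 1"
    using assms(2) by (fastforce simp: effective_null_def)
  then show "emeasure Q (space Q) \<noteq> \<infinity>"
    by (auto simp: top_unique)
qed

theorem lemma2p5:
  fixes M :: "'a measure"
    and P :: "'i \<Rightarrow> 'a measure"
    and \<Theta> \<Theta>\<^sub>0 \<Theta>\<^sub>1 :: "'i set"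
    and \<theta> :: 'i
  assumes prob: "\<And>\<eta>. \<eta> \<in> \<Theta> \<Longrightarrow> prob_space (P \<eta>)"
    and sets: "\<And>\<eta>. \<eta> \<in> \<Theta> \<Longrightarrow> sets (P \<eta>) = sets M"
    and partition: "\<Theta> = \<Theta>\<^sub>0 \<union> \<Theta>\<^sub>1" "\<Theta>\<^sub>0 \<inter> \<Theta>\<^sub>1 = {}"
    and \<theta>: "\<theta> \<in> \<Theta>"
    and finite_inf: "(INF Q\<in>effective_null M (P ` \<Theta>\<^sub>0). KL_div (P \<theta>) Q) < \<infinity>"
  shows "\<forall>E\<in>e_variables M (P ` \<Theta>\<^sub>0). expectation_defined (P \<theta>) (\<lambda>x. elog (E x))"
proof
  fix E assume E: "E \<in> e_variables M (P ` \<Theta>\<^sub>0)"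
  \<comment> \<open>An infimum below \<infinity> has a member of the family below \<infinity>;
    \<open>Q\<close> need not attain the infimum.\<close>
  obtain Q where Q: "Q \<in> effective_null M (P ` \<Theta>\<^sub>0)" and KL: "KL_div (P \<theta>) Q < \<infinity>"
    using finite_inf by (auto simp only: INF_less_iff)
  have sQ: "sets Q = sets M" and EQ: "(\<integral>\<^sup>+ x. E x \<partial>Q) \<le> 1"
    using Q E by (auto simp: effective_null_def)
  have sP: "sets (P \<theta>) = sets M"
    using sets \<theta> .
  have EM [measurable]: "E \<in> borel_measurable M"
    using E by (simp add: e_variables_def)
  have "finite_measure Q"
    using Q by (rule effective_null_finite_measure[rotated])
      (auto simp: partition prob prob_space.emeasure_space_1)
  moreover have "E \<in> borel_measurable Q"
    using EM by (simp add: measurable_cong_sets[OF sQ refl])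
  moreover have "(\<integral>\<^sup>+ x. E x \<partial>Q) < \<infinity>"
    using EQ by (rule le_less_trans) simp
  \<comment> \<open>A finite positive part suffices: the expectation is then defined, possibly with
    value -\<infinity>.\<close>
  ultimately have "(\<integral>\<^sup>+ x. e2ennreal (elog (E x)) \<partial>P \<theta>) < \<infinity>"
    using KL sP sQ by (intro nn_integral_elog_finite) auto
  moreover have "(\<lambda>x. elog (E x)) \<in> borel_measurable (P \<theta>)"
    unfolding measurable_cong_sets[OF sP refl] by measurable
  ultimately show "expectation_defined (P \<theta>) (\<lambda>x. elog (E x))"
    by (simp add: expectation_defined_def)
qed

end
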